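(* In the setting of the context, if $A\in L(Y)$ is rich, then some $B\in\sigma^{\sf op}(A)$ is self-similar and recurrent.
   Context: $Y$ is a real or complex Banach space, $L(Y)$ the bounded linear operators on $Y$. $\mathcal P=(P_n)_{n=0}^\infty\subset L(Y)$ satisfies: (i) $\sup_n\|P_nx\|=\|x\|$ for all $x\in Y$; (ii) for every $m\in\mathbb N_0$ there is $N(m)\ge m$ with $P_nP_m=P_m=P_mP_n$ for all $n\ge N(m)$. $Q_n:=I-P_n$. $K(Y,\mathcal P)$ is the set of $K\in L(Y)$ with $\|KQ_n\|\to0$ and $\|Q_nK\|\to0$ as $n\to\infty$. $\mathcal P$-convergence $A_n\stackrel{\mathcal P}{\to}A$ (for $A_n,A\in L(Y)$) means $\|(A_n-A)K\|\to0$ and $\|K(A_n-A)\|\to0$ for all $K\in K(Y,\mathcal P)$. For some $N\in\mathbb N$, $\mathcal V=\{V_k\}_{k\in\mathbb Z^N}$ is a group of linear isometries on $Y$ with $V_0=I$, $V_kV_m=V_{k+m}$, such that: for all $m,n\in\mathbb N$ there is $k_0$ with $P_mV_kP_n=0$ if $|k|>k_0$; and for all $m\in\mathbb N$, $k\in\mathbb Z^N$ there is $n_0$ with $P_mV_kQ_n=0=Q_nV_kP_m$ if $n>n_0$. If $h=(h(n))\subset\mathbb Z^N$ with $|h(n)|\to\infty$ and $V_{-h(n)}AV_{h(n)}\stackrel{\mathcal P}{\to}A_h$, then $A_h$ is the limit operator of $A$ with respect to $h$. The operator spectrum $\sigma^{\sf op}(A)$ is the set of all limit operators of $A$. $A$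 is rich if every sequence $h\subset\mathbb Z^N$ tending to infinity has a subsequence $g$ such that $A_g$ exists. $A$ is self-similar if $A\in\sigma^{\sf op}(A)$, and recurrent if $\sigma^{\sf op}(B)=\sigma^{\sf op}(A)$ for every $B\in\sigma^{\sf op}(A)$. *)

theory Defs
  imports "HOL-Analysis.Analysis"
begin

text \<open>
  A Banach space over the scalar field \<open>'k\<close>. The library class \<open>banach\<close> only knows real scalars,
  so the scalar multiplication \<open>s\<close> is an explicit parameter, required to extend the real one and to
  be compatible with the norm. By the Gelfand-Mazur theorem every \<open>real_normed_field\<close> is isometrically
  isomorphic to the reals or to the complex numbers, so the case of an arbitrary \<open>'k\<close> is precisely
  ``real or complex''.
\<close>

locale banach_space_over = vector_space s
  for s :: "'k::real_normed_field \<Rightarrow> 'a::banach \<Rightarrow> 'a" +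
  assumes scale_of_real: "s (of_real r) x = r *\<^sub>R x"
    and norm_scale: "norm (s c x) = norm c * norm x"

text \<open>The type \<open>'a \<Rightarrow>\<^sub>L 'a\<close> consists of the real-linear bounded operators, hence the restriction.\<close>

definition bdd_ops :: "('k \<Rightarrow> 'a::real_normed_vector \<Rightarrow> 'a) \<Rightarrow> ('a \<Rightarrow>\<^sub>L 'a) set" where
  "bdd_ops s = {A. \<forall>c x. blinfun_apply A (s c x) = s c (blinfun_apply A x)}"

lemma banach_space_over_scaleR: "banach_space_over (scaleR :: real \<Rightarrow> 'a::banach \<Rightarrow> 'a)"
  by unfold_locales (auto simp: algebra_simps)

lemma bdd_ops_scaleR: "bdd_ops scaleR = UNIV"
  by (auto simp: bdd_ops_def blinfun.scaleR_right)

definition coproj :: "(nat \<Rightarrow> 'a::real_normed_vector \<Rightarrow>\<^sub>L 'a) \<Rightarrow> nat \<Rightarrow> 'a \<Rightarrow>\<^sub>L 'a" where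
  "coproj P n = id_blinfun - P n"

definition P_compact ::
  "('k \<Rightarrow> 'a::real_normed_vector \<Rightarrow> 'a) \<Rightarrow> (nat \<Rightarrow> 'a \<Rightarrow>\<^sub>L 'a) \<Rightarrow> ('a \<Rightarrow>\<^sub>L 'a) set" where
  "P_compact s P = {K \<in> bdd_ops s.
     (\<lambda>n. norm (K o\<^sub>L coproj P n)) \<longlonglongrightarrow> 0 \<and> (\<lambda>n. norm (coproj P n o\<^sub>L K)) \<longlonglongrightarrow> 0}"

definition P_converges ::
  "('k \<Rightarrow> 'a::real_normed_vector \<Rightarrow> 'a) \<Rightarrow> (nat \<Rightarrow> 'a \<Rightarrow>\<^sub>L 'a) \<Rightarrow>
   (nat \<Rightarrow> 'a \<Rightarrow>\<^sub>L 'a) \<Rightarrow> ('a \<Rightarrow>\<^sub>L 'a) \<Rightarrow> bool" where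
  "P_converges s P X A \<longleftrightarrow> range X \<subseteq> bdd_ops s \<and> A \<in> bdd_ops s \<and>
     (\<forall>K \<in> P_compact s P.
        (\<lambda>n. norm ((X n - A) o\<^sub>L K)) \<longlonglongrightarrow> 0 \<and> (\<lambda>n. norm (K o\<^sub>L (X n - A))) \<longlonglongrightarrow> 0)"

text \<open>
  The lattice of \<open>N\<close>-tuples of integers is \<open>int ^ 'n\<close> with \<open>N = CARD('n)\<close>, \<open>N \<ge> 1\<close>. It carries no
  library norm, so we take the maximum norm; the choice of norm does not affect any notion below.
\<close>

definition lattice_norm :: "int ^ 'n \<Rightarrow> int" where
  "lattice_norm k = Max (range (\<lambda>i. \<bar>k $ i\<bar>))"

definition tends_to_infinity :: "(nat \<Rightarrow> int ^ 'n) \<Rightarrow> bool" where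
  "tends_to_infinity h \<longleftrightarrow> filterlim (\<lambda>n. lattice_norm (h n)) at_top sequentially"

text \<open>
  The boundedness assumption in the first property of \<open>P\<close> makes the real supremum meaningful.
  The conditions relating \<open>P\<close> and \<open>V\<close> are imposed for positive indices only; together with
  \<open>P_eventually_absorbs\<close> this implies them for index 0 as well.
\<close>

locale limit_operator_setting = banach_space_over s
  for s :: "'k::real_normed_field \<Rightarrow> 'a::banach \<Rightarrow> 'a" +
  fixes P :: "nat \<Rightarrow> 'a \<Rightarrow>\<^sub>L 'a"
    and V :: "int ^ 'n \<Rightarrow> 'a \<Rightarrow>\<^sub>L 'a"
  assumes P_in: "P n \<in> bdd_ops s"
    and P_bdd: "bdd_above (range (\<lambda>n. norm (P n x)))"
    and P_sup: "(SUP n. norm (P n x)) = norm x"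
    and P_eventually_absorbs:
      "\<exists>N\<ge>m. \<forall>n\<ge>N. P n o\<^sub>L P m = P m \<and> P m o\<^sub>L P n = P m"
    and V_in: "V k \<in> bdd_ops s"
    and V_isometry: "norm (V k x) = norm x"
    and V_0: "V 0 = id_blinfun"
    and V_add: "V k o\<^sub>L V l = V (k + l)"
    and PVP: "m \<ge> 1 \<Longrightarrow> n \<ge> 1 \<Longrightarrow>
      \<exists>k0. \<forall>k. lattice_norm k > k0 \<longrightarrow> P m o\<^sub>L V k o\<^sub>L P n = 0"
    and PVQ: "m \<ge> 1 \<Longrightarrow>
      \<exists>n0. \<forall>n>n0. P m o\<^sub>L V k o\<^sub>L coproj P n = 0 \<and> coproj P n o\<^sub>L V k o\<^sub>L P m = 0"

definition is_limit_operator ::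
  "('k \<Rightarrow> 'a::real_normed_vector \<Rightarrow> 'a) \<Rightarrow> (nat \<Rightarrow> 'a \<Rightarrow>\<^sub>L 'a) \<Rightarrow> (int ^ 'n \<Rightarrow> 'a \<Rightarrow>\<^sub>L 'a) \<Rightarrow>
   ('a \<Rightarrow>\<^sub>L 'a) \<Rightarrow> (nat \<Rightarrow> int ^ 'n) \<Rightarrow> ('a \<Rightarrow>\<^sub>L 'a) \<Rightarrow> bool" where
  "is_limit_operator s P V A h B \<longleftrightarrow> tends_to_infinity h \<and>
     P_converges s P (\<lambda>n. V (- h n) o\<^sub>L A o\<^sub>L V (h n)) B"

definition op_spectrum ::
  "('k \<Rightarrow> 'a::real_normed_vector \<Rightarrow> 'a) \<Rightarrow> (nat \<Rightarrow> 'a \<Rightarrow>\<^sub>L 'a) \<Rightarrow> (int ^ 'n \<Rightarrow> 'a \<Rightarrow>\<^sub>L 'a) \<Rightarrow>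
   ('a \<Rightarrow>\<^sub>L 'a) \<Rightarrow> ('a \<Rightarrow>\<^sub>L 'a) set" where
  "op_spectrum s P V A = {B. \<exists>h. is_limit_operator s P V A h B}"

definition rich ::
  "('k \<Rightarrow> 'a::real_normed_vector \<Rightarrow> 'a) \<Rightarrow> (nat \<Rightarrow> 'a \<Rightarrow>\<^sub>L 'a) \<Rightarrow> (int ^ 'n \<Rightarrow> 'a \<Rightarrow>\<^sub>L 'a) \<Rightarrow>
   ('a \<Rightarrow>\<^sub>L 'a) \<Rightarrow> bool" where
  "rich s P V A \<longleftrightarrow> (\<forall>h. tends_to_infinity h \<longrightarrow>
     (\<exists>r B. strict_mono r \<and> is_limit_operator s P V A (h \<circ> r) B))"

definition self_similar ::
  "('k \<Rightarrow> 'a::real_normed_vector \<Rightarrow> 'a) \<Rightarrow> (nat \<Rightarrow> 'a \<Rightarrow>\<^sub>L 'a) \<Rightarrow> (int ^ 'n \<Rightarrow> 'a \<Rightarrow>\<^sub>L 'a) \<Rightarrow>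
   ('a \<Rightarrow>\<^sub>L 'a) \<Rightarrow> bool" where
  "self_similar s P V A \<longleftrightarrow> A \<in> op_spectrum s P V A"

definition recurrent ::
  "('k \<Rightarrow> 'a::real_normed_vector \<Rightarrow> 'a) \<Rightarrow> (nat \<Rightarrow> 'a \<Rightarrow>\<^sub>L 'a) \<Rightarrow> (int ^ 'n \<Rightarrow> 'a \<Rightarrow>\<^sub>L 'a) \<Rightarrow>
   ('a \<Rightarrow>\<^sub>L 'a) \<Rightarrow> bool" where
  "recurrent s P V A \<longleftrightarrow>
     (\<forall>B \<in> op_spectrum s P V A. op_spectrum s P V B = op_spectrum s P V A)"

end

theory Submission imports Defs begin

text \<open>
  Ordering limit operators by inclusion of their operator spectra, the theorem asks for a minimal
  spectrum. Three properties of \<open>\<sigma>(B) = op_spectrum s P V B\<close> make a compactness argument work.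
  Transitivity (\<open>op_spectrum_trans\<close>): limit operators of limit operators of \<open>B\<close> are limit operators
  of \<open>B\<close>, so \<open>C \<in> \<sigma>(B)\<close> implies \<open>\<sigma>(C) \<subseteq> \<sigma>(B)\<close>. Closedness (\<open>op_spectrum_closed\<close>). And, for rich
  \<open>A\<close>, sequential compactness of \<open>\<sigma>(A)\<close> (\<open>op_spectrum_seq_compact\<close>), which also shows that limit
  operators of \<open>A\<close> are rich again and so have nonempty spectra.

  If \<open>\<sigma>(B)\<close> is minimal, in the sense that \<open>\<sigma>(C) = \<sigma>(B)\<close> for all \<open>C \<in> \<sigma>(B)\<close>, then every
  \<open>C \<in> \<sigma>(B)\<close> is an element of its own spectrum \<open>\<sigma>(C) = \<sigma>(B)\<close> and is recurrent. The existence of a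
  minimal spectrum uses only the three properties and is proved for abstract set-valued maps in
  \<open>exists_self_recurrent_point\<close>.

  The three properties are statements about approximation, and they need a single number measuring
  it. On norm bounded sequences \<open>\<P>\<close>-convergence is convergence in the weighted norm
  \<open>P_norm P\<close> (\<open>P_converges_iff_P_norm\<close>), and all shifts of one operator are bounded by its norm, so
  this norm describes limit operators completely. Transitivity needs in addition that conjugation by
  a fixed shift preserves \<open>\<P>\<close>-convergence, and this holds because
  \<open>P j o\<^sub>L V k\<close> and \<open>V k o\<^sub>L P j\<close> are unchanged by a cut-off with a suitable \<open>P n\<close> (\<open>P_V_absorb\<close>).
\<close>

section \<open>Minimal points of set-valued maps\<close>

text \<open>
  This is the dynamical kernel of the argument. In the application \<open>X\<close> and all \<open>F x\<close> are
  operator spectra. If \<open>F x\<close> is minimal among these sets, then any \<open>y \<in> F x\<close> is as required, because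
  it generates the same set \<open>F y = F x\<close> and so belongs to it.

  Zorn's lemma would ask for nonempty intersections of arbitrary chains, which sequential compactness
  does not give directly. The proof therefore reaches a minimal set in countably many steps. Call
  \<open>x\<close> minimal up to \<open>e\<close> if every \<open>F z\<close> with \<open>z \<in> F x\<close> meets every \<open>e\<close>-ball around a point of
  \<open>F x\<close>. Such points exist inside every \<open>F x\<close>: otherwise one could descend forever, losing at each
  step a point at distance at least \<open>e\<close> from everything that remains, and the lost points would have
  no Cauchy subsequence. Minimality up to \<open>e\<close> is inherited by everything further down, so a sequence
  that descends through \<open>e = 1, 1/2, 1/3, \<dots>\<close> has an accumulation point minimal up to every \<open>e\<close>,
  and closedness turns this into equality of sets.
\<close>

lemma exists_self_recurrent_point:
  fixes d :: "'b \<Rightarrow> 'b \<Rightarrow> real" and X :: "'b set" and F :: "'b \<Rightarrow> 'b set"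
  assumes sym: "\<And>x y. d x y = d y x"
    and tri: "\<And>x y z. d x z \<le> d x y + d y z"
    and compact: "\<And>f::nat \<Rightarrow> 'b. range f \<subseteq> X \<Longrightarrow>
      \<exists>r l. strict_mono (r::nat \<Rightarrow> nat) \<and> l \<in> X \<and> (\<lambda>n. d (f (r n)) l) \<longlonglongrightarrow> 0"
    and X: "X \<noteq> {}"
    and sub: "\<And>x. x \<in> X \<Longrightarrow> F x \<subseteq> X"
    and ne: "\<And>x. x \<in> X \<Longrightarrow> F x \<noteq> {}"
    and closed: "\<And>x l. x \<in> X \<Longrightarrow> l \<in> X \<Longrightarrow> (\<And>e. e > 0 \<Longrightarrow> \<exists>y\<in>F x. d y l < e) \<Longrightarrow> l \<in> F x"
    and trans: "\<And>x y. x \<in> X \<Longrightarrow> y \<in> F x \<Longrightarrow> F y \<subseteq> F x"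
  shows "\<exists>y\<in>X. y \<in> F y \<and> (\<forall>z\<in>F y. F z = F y)"
proof -
  define almost_minimal where "almost_minimal = (\<lambda>e x. \<forall>z\<in>F x. \<forall>u\<in>F x. \<exists>v\<in>F z. d v u < e)"
  have decreasing: "f m \<in> F (f n)" if "\<And>n. f n \<in> X" "\<And>n. f (Suc n) \<in> F (f n)" "n < m"
    for f :: "nat \<Rightarrow> 'b" and n m
    using \<open>n < m\<close>
  proof (induction m)
    case (Suc m)
    show ?case
    proof (cases "n = m")
      case False
      then have "f m \<in> F (f n)" using Suc by auto
      then show ?thesis using that(2)[of m] trans[OF that(1)] by blast
    qed (use that in simp)
  qed simp
  have step: "\<exists>y\<in>F x. almost_minimal e y" if "x \<in> X" "e > 0" for x e
  proof (rule ccontr)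
    assume neg: "\<not> (\<exists>y\<in>F x. almost_minimal e y)"
    have "\<exists>y. y \<in> F x" using ne[OF \<open>x \<in> X\<close>] by auto
    moreover have "\<exists>z. z \<in> F x \<and> (z \<in> F y \<and> (\<exists>u\<in>F y. \<forall>v\<in>F z. e \<le> d v u))" if "y \<in> F x" for y
    proof -
      obtain z u where "z \<in> F y" "u \<in> F y" "\<forall>v\<in>F z. e \<le> d v u"
        using neg \<open>y \<in> F x\<close> unfolding almost_minimal_def by (metis not_less)
      then show ?thesis using trans[OF \<open>x \<in> X\<close> \<open>y \<in> F x\<close>] by blast
    qed
    ultimately obtain f where f: "\<And>n. f n \<in> F x" "\<And>n. f (Suc n) \<in> F (f n)"
      "\<And>n. \<exists>u\<in>F (f n). \<forall>v\<in>F (f (Suc n)). e \<le> d v u"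
      using dependent_nat_choice[of "\<lambda>n y. y \<in> F x"
          "\<lambda>n y z. z \<in> F y \<and> (\<exists>u\<in>F y. \<forall>v\<in>F z. e \<le> d v u)"]
      by blast
    have fX: "f n \<in> X" for n using f(1) sub[OF \<open>x \<in> X\<close>] by blast
    obtain u where u: "\<And>n. u n \<in> F (f n)" "\<And>n v. v \<in> F (f (Suc n)) \<Longrightarrow> e \<le> d v (u n)"
      using f(3) by metis
    \<comment> \<open>The point \<open>u n\<close> is lost when passing from \<open>F (f n)\<close> to \<open>F (f (Suc n))\<close>, which contains
      all later \<open>u m\<close>.\<close>
    have apart: "e \<le> d (u m) (u n)" if "n < m" for m n
    proof -
      have "F (f m) \<subseteq> F (f (Suc n))"
      proof (cases "m = Suc n")
        case False
        then show ?thesis using decreasing[of f "Suc n" m, OF fX f(2)] \<open>n < m\<close> trans fX by simp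
      qed simp
      then show ?thesis using u by blast
    qed
    have "range u \<subseteq> X" using u(1) sub fX by blast
    then obtain r l where r: "strict_mono (r::nat \<Rightarrow> nat)" "(\<lambda>n. d (u (r n)) l) \<longlonglongrightarrow> 0"
      using compact by blast
    have "\<forall>\<^sub>F n in sequentially. d (u (r n)) l < e / 2"
      using r(2) \<open>e > 0\<close> by (intro order_tendstoD(2)) auto
    then obtain n where n: "\<And>m. m \<ge> n \<Longrightarrow> d (u (r m)) l < e / 2"
      by (auto simp: eventually_sequentially)
    have "r n < r (Suc n)" using r(1) by (simp add: strict_mono_Suc_iff)
    then have "e \<le> d (u (r (Suc n))) (u (r n))" by (rule apart)
    also have "\<dots> \<le> d (u (r (Suc n))) l + d (u (r n)) l"
      using tri[of "u (r (Suc n))" "u (r n)" l] sym[of l "u (r n)"] by simp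
    also have "\<dots> < e" using n[of n] n[of "Suc n"] by simp
    finally show False by simp
  qed
  define P where "P = (\<lambda>(n::nat) y. y \<in> X \<and> almost_minimal (inverse (real (Suc n))) y)"
  have "\<exists>y. P 0 y" using X step[where e="inverse (real (Suc 0))"] sub unfolding P_def by fastforce
  moreover have "\<exists>z. P (Suc n) z \<and> z \<in> F y" if "P n y" for n y
  proof -
    have "y \<in> X" using that by (simp add: P_def)
    with step[of y "inverse (real (Suc (Suc n)))"] sub[of y] show ?thesis
      unfolding P_def by auto
  qed
  ultimately obtain f where f: "\<And>n. P n (f n)" "\<And>n. f (Suc n) \<in> F (f n)"
    using dependent_nat_choice[of P "\<lambda>n y z. z \<in> F y"] by blast
  have fX: "f n \<in> X" for n using f(1) by (simp add: P_def)
  have fd: "almost_minimal (inverse (real (Suc n))) (f n)" for n using f(1) by (simp add: P_def)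
  obtain r l where r: "strict_mono (r::nat \<Rightarrow> nat)" "l \<in> X" "(\<lambda>n. d (f (r n)) l) \<longlonglongrightarrow> 0"
    using compact[of f] fX by blast
  \<comment> \<open>The tail of the descending sequence stays in the closed set \<open>F (f n)\<close>, hence so does its limit.\<close>
  have l_in: "l \<in> F (f n)" for n
  proof (rule closed[OF fX r(2)])
    fix e :: real assume "e > 0"
    then have "\<forall>\<^sub>F m in sequentially. d (f (r m)) l < e \<and> n < m"
      using r(3) eventually_gt_at_top[of n] by (intro eventually_conj order_tendstoD(2)) auto
    then obtain m where m: "d (f (r m)) l < e" "n < m"
      using eventually_happens'[OF sequentially_bot] by blast
    then have "n < r m" using seq_suble[OF r(1), of m] by simp
    then show "\<exists>y\<in>F (f n). d y l < e" using m decreasing[of f n "r m", OF fX f(2)] by blast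
  qed
  have eq: "F z = F l" if z: "z \<in> F l" for z
  proof
    show "F z \<subseteq> F l" using trans[OF r(2) z] .
    show "F l \<subseteq> F z"
    proof
      fix u assume u: "u \<in> F l"
      have zX: "z \<in> X" and uX: "u \<in> X" using sub[OF r(2)] z u by auto
      show "u \<in> F z"
      proof (rule closed[OF zX uX])
        fix e :: real assume "e > 0"
        then obtain n where n: "inverse (real (Suc n)) < e" using reals_Archimedean by blast
        have "z \<in> F (f n)" "u \<in> F (f n)" using trans[OF fX l_in] z u by auto
        then show "\<exists>y\<in>F z. d y u < e" using fd[of n] n unfolding almost_minimal_def by force
      qed
    qed
  qed
  obtain y where y: "y \<in> F l" using ne[OF r(2)] by blast
  then have "y \<in> X" using sub[OF r(2)] by blast
  with y eq show ?thesis by blast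
qed

section \<open>Sequences of lattice points tending to infinity\<close>

lemma lattice_norm_ge: "\<bar>k $ i\<bar> \<le> lattice_norm k"
  unfolding lattice_norm_def by (intro Max_ge) auto

lemma lattice_norm_le: "(\<And>i. \<bar>k $ i\<bar> \<le> c) \<Longrightarrow> lattice_norm k \<le> c"
  unfolding lattice_norm_def by (subst Max_le_iff) auto

lemma lattice_norm_add_ge: "lattice_norm h \<le> lattice_norm (h + k) + lattice_norm k"
proof (rule lattice_norm_le)
  fix i
  show "\<bar>h $ i\<bar> \<le> lattice_norm (h + k) + lattice_norm k"
    using lattice_norm_ge[of "h + k" i] lattice_norm_ge[of k i] by simp
qed

lemma tends_to_infinityI:
  assumes "\<And>n. int n \<le> lattice_norm (h n)"
  shows "tends_to_infinity h"
  unfolding tends_to_infinity_def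
proof (rule filterlim_at_top_mono[OF filterlim_int_sequentially])
qed (use assms in simp)

lemma tends_to_infinity_add:
  assumes "tends_to_infinity h"
  shows "tends_to_infinity (\<lambda>n. h n + k)"
  unfolding tends_to_infinity_def
proof (rule filterlim_at_top_mono)
  show "filterlim (\<lambda>n. - lattice_norm k + lattice_norm (h n)) at_top sequentially"
    unfolding filterlim_at_top
  proof
    fix R
    have "\<forall>\<^sub>F n in sequentially. R + lattice_norm k \<le> lattice_norm (h n)"
      using assms unfolding tends_to_infinity_def filterlim_at_top by blast
    then show "\<forall>\<^sub>F n in sequentially. R \<le> - lattice_norm k + lattice_norm (h n)"
      by (rule eventually_mono) simp
  qed
  show "\<forall>\<^sub>F n in sequentially. - lattice_norm k + lattice_norm (h n) \<le> lattice_norm (h n + k)"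
    proof (rule always_eventually, rule allI)
    show "- lattice_norm k + lattice_norm (h n) \<le> lattice_norm (h n + k)" for n
      using lattice_norm_add_ge[of "h n" k] by simp
  qed
qed

lemma tends_to_infinity_exists: "\<exists>h :: nat \<Rightarrow> int ^ 'n. tends_to_infinity h"
proof
  show "tends_to_infinity (\<lambda>n. (\<chi> i. int n) :: int ^ 'n)"
    by (rule tends_to_infinityI) (simp add: lattice_norm_def)
qed

section \<open>A norm for convergence of bounded sequences\<close>

lemma blinfun_compose_assoc: "(a o\<^sub>L b) o\<^sub>L c = a o\<^sub>L (b o\<^sub>L c)"
  by (rule blinfun_eqI) simp

lemma norm_blinfun_compose3_le:
  assumes "norm a \<le> 1" "norm c \<le> 1"
  shows "norm (a o\<^sub>L b o\<^sub>L c) \<le> norm b"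
proof -
  have "norm (a o\<^sub>L b o\<^sub>L c) \<le> norm a * norm b * norm c"
    by (intro order_trans[OF norm_blinfun_compose] mult_right_mono norm_blinfun_compose norm_ge_zero)
  also have "\<dots> \<le> 1 * norm b * 1"
    using assms by (intro mult_mono) auto
  finally show ?thesis by simp
qed

lemmas blinfun_compose_simps =
  bounded_bilinear.add_left[OF bounded_bilinear_blinfun_compose]
  bounded_bilinear.add_right[OF bounded_bilinear_blinfun_compose]
  bounded_bilinear.diff_left[OF bounded_bilinear_blinfun_compose]
  bounded_bilinear.diff_right[OF bounded_bilinear_blinfun_compose]

definition conj_shift ::
  "(int ^ 'n \<Rightarrow> 'a::real_normed_vector \<Rightarrow>\<^sub>L 'a) \<Rightarrow> int ^ 'n \<Rightarrow> ('a \<Rightarrow>\<^sub>L 'a) \<Rightarrow> 'a \<Rightarrow>\<^sub>L 'a" where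
  "conj_shift V k T = V (- k) o\<^sub>L T o\<^sub>L V k"

text \<open>
  The seminorms test an operator against the projections only. Since every \<open>K\<close> in
  \<open>P_compact s P\<close> is a norm limit of the \<open>K o\<^sub>L P j\<close> and of the \<open>P j o\<^sub>L K\<close>, this suffices for
  \<open>\<P>\<close>-convergence of bounded sequences.
\<close>

definition P_seminorm :: "(nat \<Rightarrow> 'a::real_normed_vector \<Rightarrow>\<^sub>L 'a) \<Rightarrow> nat \<Rightarrow> ('a \<Rightarrow>\<^sub>L 'a) \<Rightarrow> real" where
  "P_seminorm P j T = norm (P j o\<^sub>L T) + norm (T o\<^sub>L P j)"

text \<open>
  The weights tend to \<open>0\<close>, so that on norm bounded sets only finitely many seminorms matter up to
  a given error. Thus one number controls \<open>\<P>\<close>-convergence, and sequential arguments become metric.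
\<close>

definition P_norm :: "(nat \<Rightarrow> 'a::real_normed_vector \<Rightarrow>\<^sub>L 'a) \<Rightarrow> ('a \<Rightarrow>\<^sub>L 'a) \<Rightarrow> real" where
  "P_norm P T = (SUP j. P_seminorm P j T / real (Suc j))"

lemma P_seminorm_nonneg: "0 \<le> P_seminorm P j T"
  by (simp add: P_seminorm_def)

lemma P_seminorm_uminus: "P_seminorm P j (S - T) = P_seminorm P j (T - S)"
  by (simp add: P_seminorm_def norm_minus_commute blinfun_compose_simps)

lemma P_norm_diff_commute: "P_norm P (S - T) = P_norm P (T - S)"
  by (simp add: P_norm_def P_seminorm_uminus)

lemma P_seminorm_add: "P_seminorm P j (S + T) \<le> P_seminorm P j S + P_seminorm P j T"
  unfolding P_seminorm_def blinfun_compose_simps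
  using norm_triangle_ineq[of "P j o\<^sub>L S" "P j o\<^sub>L T"] norm_triangle_ineq[of "S o\<^sub>L P j" "T o\<^sub>L P j"]
  by linarith

context limit_operator_setting
begin

lemma norm_V_le: "norm (V k) \<le> 1"
  by (rule norm_blinfun_bound) (simp_all add: V_isometry)

lemma norm_P_le: "norm (P j) \<le> 1"
proof (rule norm_blinfun_bound)
  fix x
  have "norm (P j x) \<le> (SUP n. norm (P n x))"
    by (rule cSUP_upper[OF UNIV_I P_bdd])
  then show "norm (P j x) \<le> 1 * norm x" by (simp add: P_sup)
qed simp

lemma P_seminorm_le: "P_seminorm P j T \<le> 2 * norm T"
proof -
  have "norm (P j o\<^sub>L T) \<le> norm T" "norm (T o\<^sub>L P j) \<le> norm T"
    using norm_blinfun_compose[of "P j" T] norm_blinfun_compose[of T "P j"]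
      mult_right_mono[OF norm_P_le[of j] norm_ge_zero[of T]]
      mult_left_mono[OF norm_P_le[of j] norm_ge_zero[of T]] by auto
  then show ?thesis by (simp add: P_seminorm_def)
qed

lemma P_norm_bdd: "bdd_above (range (\<lambda>j. P_seminorm P j T / real (Suc j)))"
proof (rule bdd_aboveI2)
  fix j
  have "P_seminorm P j T / real (Suc j) \<le> P_seminorm P j T / 1"
    by (intro divide_left_mono P_seminorm_nonneg) auto
  with P_seminorm_le[of j T] show "P_seminorm P j T / real (Suc j) \<le> 2 * norm T" by (simp del: of_nat_Suc)
qed

lemma P_seminorm_le_P_norm: "P_seminorm P j T \<le> real (Suc j) * P_norm P T"
  using cSUP_upper[OF UNIV_I P_norm_bdd, of j T] unfolding P_norm_def
  by (simp add: divide_le_eq mult.commute)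

lemma P_norm_nonneg: "0 \<le> P_norm P T"
  using order_trans[OF P_seminorm_nonneg P_seminorm_le_P_norm[of 0 T]] by simp

lemma P_norm_add: "P_norm P (S + T) \<le> P_norm P S + P_norm P T"
  unfolding P_norm_def[of P "S + T"]
proof (rule cSUP_least)
  fix j
  have "P_seminorm P j (S + T) \<le> P_seminorm P j S + P_seminorm P j T" by (rule P_seminorm_add)
  also have "\<dots> \<le> real (Suc j) * (P_norm P S + P_norm P T)"
    using P_seminorm_le_P_norm[of j S] P_seminorm_le_P_norm[of j T] by (simp add: algebra_simps)
  finally show "P_seminorm P j (S + T) / real (Suc j) \<le> P_norm P S + P_norm P T"
    by (simp add: divide_le_eq mult.commute)
qed simp

lemma P_norm_triangle: "P_norm P (S - U) \<le> P_norm P (S - T) + P_norm P (T - U)"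
  using P_norm_add[of "S - T" "T - U"] by simp

text \<open>
  On bounded sequences the seminorms beyond a large index \<open>J\<close> contribute at most \<open>2 * M / J\<close> to the
  supremum, uniformly along the sequence, and the finitely many others tend to \<open>0\<close> simultaneously.
\<close>

lemma P_norm_tendsto_0_iff:
  assumes bound: "\<And>n. norm (T n) \<le> M"
  shows "(\<lambda>n. P_norm P (T n)) \<longlonglongrightarrow> 0 \<longleftrightarrow> (\<forall>j. (\<lambda>n. P_seminorm P j (T n)) \<longlonglongrightarrow> 0)"
proof safe
  fix j
  assume "(\<lambda>n. P_norm P (T n)) \<longlonglongrightarrow> 0"
  then have "(\<lambda>n. real (Suc j) * P_norm P (T n)) \<longlonglongrightarrow> 0" by (rule tendsto_mult_right_zero)
  then show "(\<lambda>n. P_seminorm P j (T n)) \<longlonglongrightarrow> 0"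
    by (rule Lim_null_comparison[rotated])
      (intro always_eventually allI, simp only: real_norm_def abs_of_nonneg[OF P_seminorm_nonneg]
        P_seminorm_le_P_norm)
next
  assume lim: "\<forall>j. (\<lambda>n. P_seminorm P j (T n)) \<longlonglongrightarrow> 0"
  have M: "M \<ge> 0" using order_trans[OF norm_ge_zero bound[of 0]] .
  show "(\<lambda>n. P_norm P (T n)) \<longlonglongrightarrow> 0"
  proof (rule LIMSEQ_I)
    fix e :: real assume "e > 0"
    \<comment> \<open>The seminorms are bounded by \<open>2 * M\<close>, so with the weights those of index above
      \<open>J\<close> are at most \<open>e / 2\<close>.\<close>
    obtain J :: nat where J: "4 * M / e < real J" using reals_Archimedean2 by blast
    have "\<forall>\<^sub>F n in sequentially. \<forall>j\<in>{..J}. P_seminorm P j (T n) < e / 2"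
      using lim \<open>e > 0\<close> by (intro eventually_ball_finite) (auto intro!: order_tendstoD(2))
    then obtain n0 where n0: "\<And>n j. n \<ge> n0 \<Longrightarrow> j \<le> J \<Longrightarrow> P_seminorm P j (T n) < e / 2"
      by (auto simp: eventually_sequentially)
    have "P_norm P (T n) \<le> e / 2" if "n \<ge> n0" for n
      unfolding P_norm_def
    proof (rule cSUP_least)
      fix j
      show "P_seminorm P j (T n) / real (Suc j) \<le> e / 2"
      proof (cases "j \<le> J")
        case True
        have "P_seminorm P j (T n) / real (Suc j) \<le> P_seminorm P j (T n) / 1"
          by (intro divide_left_mono P_seminorm_nonneg) auto
        with n0[OF that True] show ?thesis by linarith
      next
        case False
        have "P_seminorm P j (T n) \<le> 2 * M" using P_seminorm_le[of j "T n"] bound[of n] by simp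
        also have "\<dots> \<le> e / 2 * real J" using J \<open>e > 0\<close> by (simp add: field_simps)
        also have "\<dots> \<le> e / 2 * real (Suc j)"
          using False \<open>e > 0\<close> by (intro mult_left_mono) auto
        finally show ?thesis by (simp add: divide_le_eq)
      qed
    qed simp
    then show "\<exists>n0. \<forall>n\<ge>n0. norm (P_norm P (T n) - 0) < e"
      using \<open>e > 0\<close> P_norm_nonneg by (intro exI[of _ n0]) (fastforce simp: abs_of_nonneg)
  qed
qed

lemma P_in_P_compact: "P j \<in> P_compact s P"
proof -
  obtain N where N: "\<And>n. n \<ge> N \<Longrightarrow> P n o\<^sub>L P j = P j \<and> P j o\<^sub>L P n = P j"
    using P_eventually_absorbs by blast
  have id: "id_blinfun o\<^sub>L P j = P j" "P j o\<^sub>L id_blinfun = P j"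
    by (rule blinfun_eqI, simp)+
  have "\<forall>\<^sub>F n in sequentially. norm (P j o\<^sub>L coproj P n) = 0"
    "\<forall>\<^sub>F n in sequentially. norm (coproj P n o\<^sub>L P j) = 0"
    by (auto simp: eventually_sequentially coproj_def blinfun_compose_simps id N
        intro!: exI[of _ N])
  then show ?thesis unfolding P_compact_def
    using P_in by (auto intro: tendsto_eventually)
qed

text \<open>
  Split \<open>K\<close> into \<open>P j o\<^sub>L K\<close> and \<open>coproj P j o\<^sub>L K\<close> (and likewise on the other side). The second part
  is small uniformly in \<open>n\<close> because \<open>T\<close> is bounded, and for fixed \<open>j\<close> the seminorm controls the first.
\<close>

lemma P_seminorm_tendsto_imp_compose:
  assumes bound: "\<And>n. norm (T n) \<le> M"
    and lim: "\<And>j. (\<lambda>n. P_seminorm P j (T n)) \<longlonglongrightarrow> 0"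
    and K: "K \<in> P_compact s P"
  shows "(\<lambda>n. norm (T n o\<^sub>L K)) \<longlonglongrightarrow> 0" and "(\<lambda>n. norm (K o\<^sub>L T n)) \<longlonglongrightarrow> 0"
proof -
  have M: "M \<ge> 0" using order_trans[OF norm_ge_zero bound[of 0]] .
  have lim1: "(\<lambda>n. norm (coproj P n o\<^sub>L K)) \<longlonglongrightarrow> 0" and lim2: "(\<lambda>n. norm (K o\<^sub>L coproj P n)) \<longlonglongrightarrow> 0"
    using K by (auto simp: P_compact_def)
  have split1: "norm (T n o\<^sub>L K) \<le> P_seminorm P j (T n) * norm K + M * norm (coproj P j o\<^sub>L K)" for n j
  proof -
    have "T n o\<^sub>L K = ((T n o\<^sub>L P j) o\<^sub>L K) + (T n o\<^sub>L (coproj P j o\<^sub>L K))"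
      by (rule blinfun_eqI) (simp add: coproj_def blinfun.bilinear_simps)
    then have "norm (T n o\<^sub>L K) \<le> norm (T n o\<^sub>L P j) * norm K + norm (T n) * norm (coproj P j o\<^sub>L K)"
      by (metis norm_triangle_le add_mono norm_blinfun_compose)
    also have "\<dots> \<le> P_seminorm P j (T n) * norm K + M * norm (coproj P j o\<^sub>L K)"
      using bound by (intro add_mono mult_right_mono) (auto simp: P_seminorm_def)
    finally show ?thesis .
  qed
  have split2: "norm (K o\<^sub>L T n) \<le> P_seminorm P j (T n) * norm K + M * norm (K o\<^sub>L coproj P j)" for n j
  proof -
    have "K o\<^sub>L T n = (K o\<^sub>L (P j o\<^sub>L T n)) + ((K o\<^sub>L coproj P j) o\<^sub>L T n)"
      by (rule blinfun_eqI) (simp add: coproj_def blinfun.bilinear_simps)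
    then have "norm (K o\<^sub>L T n) \<le> norm K * norm (P j o\<^sub>L T n) + norm (K o\<^sub>L coproj P j) * norm (T n)"
      by (metis norm_triangle_le add_mono norm_blinfun_compose)
    also have "\<dots> \<le> norm K * P_seminorm P j (T n) + norm (K o\<^sub>L coproj P j) * M"
      using bound by (intro add_mono mult_left_mono) (auto simp: P_seminorm_def)
    finally show ?thesis by (simp add: mult.commute)
  qed
  have approx: "a \<longlonglongrightarrow> 0"
    if a: "\<And>n. 0 \<le> a n" "\<And>n j. a n \<le> P_seminorm P j (T n) * norm K + M * q j" and q: "q \<longlonglongrightarrow> 0"
    for a q :: "nat \<Rightarrow> real"
  proof (rule LIMSEQ_I)
    fix e :: real assume "e > 0"
    have "(\<lambda>j. M * q j) \<longlonglongrightarrow> 0" using q by (rule tendsto_mult_right_zero)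
    then have "\<forall>\<^sub>F j in sequentially. M * q j < e / 2"
      using \<open>e > 0\<close> by (intro order_tendstoD(2)) auto
    then obtain j where j: "M * q j < e / 2"
      using eventually_happens'[OF sequentially_bot] by blast
    have "(\<lambda>n. P_seminorm P j (T n) * norm K) \<longlonglongrightarrow> 0" using lim by (rule tendsto_mult_left_zero)
    then have "\<forall>\<^sub>F n in sequentially. P_seminorm P j (T n) * norm K < e / 2"
      using \<open>e > 0\<close> by (intro order_tendstoD(2)) auto
    then obtain n0 where n0: "\<And>n. n \<ge> n0 \<Longrightarrow> P_seminorm P j (T n) * norm K < e / 2"
      by (auto simp: eventually_sequentially)
    have "norm (a n - 0) < e" if "n \<ge> n0" for n
      using a(1)[of n] a(2)[of n j] j n0[OF that] by simp
    then show "\<exists>n0. \<forall>n\<ge>n0. norm (a n - 0) < e" by blast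
  qed
  show "(\<lambda>n. norm (T n o\<^sub>L K)) \<longlonglongrightarrow> 0" by (rule approx[OF norm_ge_zero split1 lim1])
  show "(\<lambda>n. norm (K o\<^sub>L T n)) \<longlonglongrightarrow> 0" by (rule approx[OF norm_ge_zero split2 lim2])
qed

lemma P_converges_iff_P_norm:
  assumes bound: "\<And>n. norm (X n) \<le> M"
  shows "P_converges s P X B \<longleftrightarrow>
    range X \<subseteq> bdd_ops s \<and> B \<in> bdd_ops s \<and> (\<lambda>n. P_norm P (X n - B)) \<longlonglongrightarrow> 0"
proof -
  have bound': "norm (X n - B) \<le> M + norm B" for n
    using norm_triangle_ineq4[of "X n" B] bound[of n] by simp
  have "(\<forall>j. (\<lambda>n. P_seminorm P j (X n - B)) \<longlonglongrightarrow> 0) \<longleftrightarrow>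
    (\<forall>K \<in> P_compact s P. (\<lambda>n. norm ((X n - B) o\<^sub>L K)) \<longlonglongrightarrow> 0 \<and> (\<lambda>n. norm (K o\<^sub>L (X n - B))) \<longlonglongrightarrow> 0)"
    (is "?L \<longleftrightarrow> ?R")
  proof
    show ?R if ?L
      using P_seminorm_tendsto_imp_compose[where T="\<lambda>n. X n - B", OF bound'] that by blast
    assume R: ?R
    show ?L unfolding P_seminorm_def
      using R P_in_P_compact by (auto intro!: tendsto_add_zero)
  qed
  then show ?thesis unfolding P_converges_def P_norm_tendsto_0_iff[OF bound'] by blast
qed

section \<open>Conjugation by shifts\<close>

lemma norm_conj_shift_le: "norm (conj_shift V k T) \<le> norm T"
  unfolding conj_shift_def by (intro norm_blinfun_compose3_le norm_V_le)

lemma conj_shift_add: "conj_shift V k (conj_shift V h T) = conj_shift V (h + k) T"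
proof -
  have "conj_shift V k (conj_shift V h T) = (V (- k) o\<^sub>L V (- h)) o\<^sub>L T o\<^sub>L (V h o\<^sub>L V k)"
    by (simp add: conj_shift_def blinfun_compose_assoc)
  then show ?thesis by (simp add: V_add conj_shift_def add.commute)
qed

lemma conj_shift_diff: "conj_shift V k (S - T) = conj_shift V k S - conj_shift V k T"
  by (rule blinfun_eqI) (simp add: conj_shift_def blinfun.bilinear_simps)

lemma conj_shift_in_bdd_ops: "T \<in> bdd_ops s \<Longrightarrow> conj_shift V k T \<in> bdd_ops s"
  using V_in by (auto simp: bdd_ops_def conj_shift_def)

text \<open>
  A shift by a fixed vector has finite propagation with respect to \<open>P\<close>. Index \<open>0\<close> is covered because
  \<open>P 0\<close> is absorbed by some \<open>P m\<close> with \<open>m \<ge> 1\<close>.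
\<close>

lemma P_V_absorb: "\<exists>n. P j o\<^sub>L V k = P j o\<^sub>L V k o\<^sub>L P n \<and> V k o\<^sub>L P j = P n o\<^sub>L V k o\<^sub>L P j"
proof -
  obtain N where N: "\<And>n. n \<ge> N \<Longrightarrow> P n o\<^sub>L P j = P j \<and> P j o\<^sub>L P n = P j"
    using P_eventually_absorbs by blast
  define m where "m = max 1 N"
  have m: "P m o\<^sub>L P j = P j" "P j o\<^sub>L P m = P j" "m \<ge> 1" using N by (auto simp: m_def)
  obtain n0 where n0: "\<And>n. n > n0 \<Longrightarrow> P m o\<^sub>L V k o\<^sub>L coproj P n = 0 \<and> coproj P n o\<^sub>L V k o\<^sub>L P m = 0"
    using PVQ[OF m(3)] by blast
  define n where "n = Suc n0"
  have z: "P m o\<^sub>L V k o\<^sub>L coproj P n = 0" "coproj P n o\<^sub>L V k o\<^sub>L P m = 0"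
    using n0[of n] by (simp_all add: n_def)
  have "(P j o\<^sub>L V k) - (P j o\<^sub>L V k o\<^sub>L P n) = (P j o\<^sub>L P m) o\<^sub>L V k o\<^sub>L coproj P n"
    unfolding m(2) by (rule blinfun_eqI) (simp add: coproj_def blinfun.bilinear_simps)
  also have "\<dots> = P j o\<^sub>L (P m o\<^sub>L V k o\<^sub>L coproj P n)" by (simp add: blinfun_compose_assoc)
  finally have 1: "(P j o\<^sub>L V k) - (P j o\<^sub>L V k o\<^sub>L P n) = 0" by (simp add: z)
  have "(V k o\<^sub>L P j) - (P n o\<^sub>L V k o\<^sub>L P j) = coproj P n o\<^sub>L V k o\<^sub>L (P m o\<^sub>L P j)"
    unfolding m(1) by (rule blinfun_eqI) (simp add: coproj_def blinfun.bilinear_simps)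
  also have "\<dots> = (coproj P n o\<^sub>L V k o\<^sub>L P m) o\<^sub>L P j" by (simp add: blinfun_compose_assoc)
  finally have 2: "(V k o\<^sub>L P j) - (P n o\<^sub>L V k o\<^sub>L P j) = 0" by (simp add: z)
  from 1 2 show ?thesis by auto
qed

lemma P_seminorm_conj_shift_le:
  "\<exists>m n. \<forall>T. P_seminorm P j (conj_shift V k T) \<le> P_seminorm P m T + P_seminorm P n T"
proof -
  obtain m where m: "P j o\<^sub>L V (- k) = P j o\<^sub>L V (- k) o\<^sub>L P m" using P_V_absorb by blast
  obtain n where n: "V k o\<^sub>L P j = P n o\<^sub>L V k o\<^sub>L P j" using P_V_absorb by blast
  have PV: "norm (P j o\<^sub>L V l) \<le> 1" "norm (V l o\<^sub>L P j) \<le> 1" for l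
    using norm_blinfun_compose[of "P j" "V l"] norm_blinfun_compose[of "V l" "P j"]
      mult_le_one[OF norm_P_le norm_ge_zero norm_V_le, of j l]
    by (simp_all add: mult.commute)
  have "P_seminorm P j (conj_shift V k T) \<le> P_seminorm P m T + P_seminorm P n T" for T
  proof -
    have "P j o\<^sub>L conj_shift V k T = (P j o\<^sub>L V (- k)) o\<^sub>L T o\<^sub>L V k"
      by (simp add: conj_shift_def blinfun_compose_assoc)
    also have "\<dots> = (P j o\<^sub>L V (- k)) o\<^sub>L (P m o\<^sub>L T) o\<^sub>L V k"
      by (subst m) (simp add: blinfun_compose_assoc)
    finally have 1: "norm (P j o\<^sub>L conj_shift V k T) \<le> norm (P m o\<^sub>L T)"
      using norm_blinfun_compose3_le[OF PV(1) norm_V_le] by metis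
    have "conj_shift V k T o\<^sub>L P j = V (- k) o\<^sub>L T o\<^sub>L (V k o\<^sub>L P j)"
      by (simp add: conj_shift_def blinfun_compose_assoc)
    also have "\<dots> = V (- k) o\<^sub>L (T o\<^sub>L P n) o\<^sub>L (V k o\<^sub>L P j)"
      by (subst n) (simp add: blinfun_compose_assoc)
    finally have 2: "norm (conj_shift V k T o\<^sub>L P j) \<le> norm (T o\<^sub>L P n)"
      using norm_blinfun_compose3_le[OF norm_V_le PV(2)] by metis
    have "norm (P j o\<^sub>L conj_shift V k T) + norm (conj_shift V k T o\<^sub>L P j)
      \<le> norm (P m o\<^sub>L T) + norm (T o\<^sub>L P n)" using 1 2 by (rule add_mono)
    also have "\<dots> \<le> P_seminorm P m T + P_seminorm P n T" by (simp add: P_seminorm_def)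
    finally show ?thesis by (simp add: P_seminorm_def)
  qed
  then show ?thesis by blast
qed

text \<open>
  Conjugation by a fixed shift is continuous for \<open>\<P>\<close>-convergence of bounded sequences. A Lipschitz
  estimate in \<open>P_norm\<close> cannot be expected, since the indices in \<open>P_seminorm_conj_shift_le\<close> may grow
  arbitrarily fast with \<open>j\<close>.
\<close>

lemma P_norm_conj_shift_tendsto_0:
  assumes bound: "\<And>n. norm (T n) \<le> M" and lim: "(\<lambda>n. P_norm P (T n)) \<longlonglongrightarrow> 0"
  shows "(\<lambda>n. P_norm P (conj_shift V k (T n))) \<longlonglongrightarrow> 0"
proof -
  have "norm (conj_shift V k (T n)) \<le> M" for n
    using order_trans[OF norm_conj_shift_le bound] .
  note * = P_norm_tendsto_0_iff[OF this]
  show ?thesis unfolding *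
  proof
    fix j
    obtain m n where mn: "\<And>T. P_seminorm P j (conj_shift V k T) \<le> P_seminorm P m T + P_seminorm P n T"
      using P_seminorm_conj_shift_le by blast
    have "(\<lambda>i. P_seminorm P m (T i) + P_seminorm P n (T i)) \<longlonglongrightarrow> 0"
      using lim unfolding P_norm_tendsto_0_iff[OF bound] by (intro tendsto_add_zero) auto
    then show "(\<lambda>i. P_seminorm P j (conj_shift V k (T i))) \<longlonglongrightarrow> 0"
      by (rule Lim_null_comparison[rotated]) (simp add: P_seminorm_nonneg mn)
  qed
qed

section \<open>Operator spectra are closed, transitive and sequentially compact\<close>

lemma is_limit_operator_iff:
  assumes "A \<in> bdd_ops s"
  shows "is_limit_operator s P V A h B \<longleftrightarrow>
    tends_to_infinity h \<and> B \<in> bdd_ops s \<and> (\<lambda>n. P_norm P (conj_shift V (h n) A - B)) \<longlonglongrightarrow> 0"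
proof -
  have "range (\<lambda>n. conj_shift V (h n) A) \<subseteq> bdd_ops s" using conj_shift_in_bdd_ops[OF assms] by blast
  then show ?thesis
    using P_converges_iff_P_norm[of "\<lambda>n. conj_shift V (h n) A" "norm A" B] norm_conj_shift_le
    unfolding is_limit_operator_def conj_shift_def[symmetric] by blast
qed

text \<open>
  The sequence in the definition of a limit operator can be chosen entry by entry once approximation
  is measured by a single number. The resulting sequence-free description makes closedness and
  transitivity immediate.
\<close>

lemma op_spectrum_iff:
  assumes A: "A \<in> bdd_ops s"
  shows "B \<in> op_spectrum s P V A \<longleftrightarrow> B \<in> bdd_ops s \<and>
    (\<forall>R. \<forall>e>0. \<exists>k. R \<le> lattice_norm k \<and> P_norm P (conj_shift V k A - B) < e)"
proof safe
  assume "B \<in> op_spectrum s P V A"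
  then obtain h where h: "tends_to_infinity h" "B \<in> bdd_ops s"
    "(\<lambda>n. P_norm P (conj_shift V (h n) A - B)) \<longlonglongrightarrow> 0"
    unfolding op_spectrum_def using is_limit_operator_iff[OF A] by blast
  show "B \<in> bdd_ops s" by fact
  fix R :: int and e :: real assume "e > 0"
  have "\<forall>\<^sub>F n in sequentially. R \<le> lattice_norm (h n)"
    using h(1) unfolding tends_to_infinity_def filterlim_at_top by blast
  moreover have "\<forall>\<^sub>F n in sequentially. P_norm P (conj_shift V (h n) A - B) < e"
    using h(3) \<open>e > 0\<close> by (intro order_tendstoD(2)) auto
  ultimately have "\<forall>\<^sub>F n in sequentially. R \<le> lattice_norm (h n) \<and> P_norm P (conj_shift V (h n) A - B) < e"
    by (rule eventually_conj)
  then show "\<exists>k. R \<le> lattice_norm k \<and> P_norm P (conj_shift V k A - B) < e"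
    using eventually_happens'[OF sequentially_bot] by blast
next
  assume B: "B \<in> bdd_ops s"
    and near: "\<forall>R. \<forall>e>0. \<exists>k. R \<le> lattice_norm k \<and> P_norm P (conj_shift V k A - B) < e"
  have "\<forall>n. \<exists>k. int n \<le> lattice_norm k \<and> P_norm P (conj_shift V k A - B) < inverse (real (Suc n))"
    using near by simp
  then obtain h where h: "\<And>n. int n \<le> lattice_norm (h n)"
    "\<And>n. P_norm P (conj_shift V (h n) A - B) < inverse (real (Suc n))" by metis
  have "(\<lambda>n. P_norm P (conj_shift V (h n) A - B)) \<longlonglongrightarrow> 0"
    by (rule Lim_null_comparison[OF _ LIMSEQ_inverse_real_of_nat])
      (use h(2) in \<open>simp add: P_norm_nonneg less_imp_le\<close>)
  then show "B \<in> op_spectrum s P V A"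
    unfolding op_spectrum_def using is_limit_operator_iff[OF A] B tends_to_infinityI[of h, OF h(1)] by blast
qed

lemma op_spectrum_in_bdd_ops: "B \<in> op_spectrum s P V A \<Longrightarrow> B \<in> bdd_ops s"
  unfolding op_spectrum_def is_limit_operator_def P_converges_def by blast

lemma op_spectrum_closed:
  assumes A: "A \<in> bdd_ops s" and L: "L \<in> bdd_ops s"
    and near: "\<And>e. e > 0 \<Longrightarrow> \<exists>B\<in>op_spectrum s P V A. P_norm P (B - L) < e"
  shows "L \<in> op_spectrum s P V A"
  unfolding op_spectrum_iff[OF A]
proof (intro conjI L allI impI)
  fix R :: int and e :: real assume "e > 0"
  obtain B where B: "B \<in> op_spectrum s P V A" "P_norm P (B - L) < e / 2"
    using near[of "e / 2"] \<open>e > 0\<close> by auto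
  obtain k where k: "R \<le> lattice_norm k" "P_norm P (conj_shift V k A - B) < e / 2"
    using B(1) \<open>e > 0\<close> unfolding op_spectrum_iff[OF A] by (meson half_gt_zero)
  show "\<exists>k. R \<le> lattice_norm k \<and> P_norm P (conj_shift V k A - L) < e"
    using P_norm_triangle[of "conj_shift V k A" L B] k B(2) by (intro exI[of _ k]) simp
qed

text \<open>
  If \<open>h\<close> produces \<open>B\<close>, then \<open>h + k\<close> produces the shifted operator.
\<close>

lemma conj_shift_in_op_spectrum:
  assumes A: "A \<in> bdd_ops s" and B: "B \<in> op_spectrum s P V A"
  shows "conj_shift V k B \<in> op_spectrum s P V A"
proof -
  obtain h where h: "tends_to_infinity h" "B \<in> bdd_ops s"
    "(\<lambda>n. P_norm P (conj_shift V (h n) A - B)) \<longlonglongrightarrow> 0"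
    using B unfolding op_spectrum_def using is_limit_operator_iff[OF A] by blast
  have "norm (conj_shift V (h n) A - B) \<le> norm A + norm B" for n
    using norm_triangle_ineq4[of "conj_shift V (h n) A" B] norm_conj_shift_le[of "h n" A] by simp
  from P_norm_conj_shift_tendsto_0[OF this h(3), of k]
  have "(\<lambda>n. P_norm P (conj_shift V (h n + k) A - conj_shift V k B)) \<longlonglongrightarrow> 0"
    by (simp add: conj_shift_diff conj_shift_add)
  then have "is_limit_operator s P V A (\<lambda>n. h n + k) (conj_shift V k B)"
    unfolding is_limit_operator_iff[OF A]
    using tends_to_infinity_add[OF h(1)] conj_shift_in_bdd_ops[OF h(2)] by blast
  then show ?thesis unfolding op_spectrum_def by blast
qed

text \<open>
  A limit operator of \<open>B\<close> is approximated by shifts of \<open>B\<close>. These lie in the operator spectrum of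
  \<open>A\<close>, which is shift invariant and closed.
\<close>

lemma op_spectrum_trans:
  assumes A: "A \<in> bdd_ops s" and B: "B \<in> op_spectrum s P V A"
  shows "op_spectrum s P V B \<subseteq> op_spectrum s P V A"
proof
  fix C assume C: "C \<in> op_spectrum s P V B"
  have Bb: "B \<in> bdd_ops s" and Cb: "C \<in> bdd_ops s" using B C op_spectrum_in_bdd_ops by auto
  show "C \<in> op_spectrum s P V A"
  proof (rule op_spectrum_closed[OF A Cb])
    fix e :: real assume "e > 0"
    then obtain k where "P_norm P (conj_shift V k B - C) < e"
      using C unfolding op_spectrum_iff[OF Bb] by blast
    then show "\<exists>D\<in>op_spectrum s P V A. P_norm P (D - C) < e"
      using conj_shift_in_op_spectrum[OF A B] by blast
  qed
qed

text \<open>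
  Each \<open>B n\<close> is within \<open>1 / (n + 1)\<close> of a shift of \<open>A\<close> by a vector \<open>h n\<close> of length at least \<open>n\<close>.
  Richness, applied to \<open>h\<close>, gives a convergent subsequence of these shifts, and \<open>B\<close> follows it.
\<close>

lemma op_spectrum_seq_compact:
  assumes A: "A \<in> bdd_ops s" and rich: "rich s P V A"
    and B: "range B \<subseteq> op_spectrum s P V A"
  shows "\<exists>r C. strict_mono (r::nat \<Rightarrow> nat) \<and> C \<in> op_spectrum s P V A \<and> (\<lambda>n. P_norm P (B (r n) - C)) \<longlonglongrightarrow> 0"
proof -
  have "\<forall>n. \<exists>k. int n \<le> lattice_norm k \<and> P_norm P (conj_shift V k A - B n) < inverse (real (Suc n))"
    using B op_spectrum_iff[OF A] by (simp add: image_subset_iff)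
  then obtain h where h: "\<And>n. int n \<le> lattice_norm (h n)"
    "\<And>n. P_norm P (conj_shift V (h n) A - B n) < inverse (real (Suc n))" by metis
  obtain r C where r: "strict_mono r" and lim: "is_limit_operator s P V A (h \<circ> r) C"
    using rich tends_to_infinityI[of h, OF h(1)] unfolding rich_def by blast
  have C: "(\<lambda>n. P_norm P (conj_shift V (h (r n)) A - C)) \<longlonglongrightarrow> 0"
    using lim unfolding is_limit_operator_iff[OF A] by simp
  have "(\<lambda>n. inverse (real (Suc (r n)))) \<longlonglongrightarrow> 0"
    using LIMSEQ_subseq_LIMSEQ[OF LIMSEQ_inverse_real_of_nat r] by (simp add: o_def)
  then have "(\<lambda>n. inverse (real (Suc (r n))) + P_norm P (conj_shift V (h (r n)) A - C)) \<longlonglongrightarrow> 0"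
    using C by (rule tendsto_add_zero)
  moreover have "norm (P_norm P (B (r n) - C))
      \<le> inverse (real (Suc (r n))) + P_norm P (conj_shift V (h (r n)) A - C)" for n
    using P_norm_triangle[of "B (r n)" C "conj_shift V (h (r n)) A"] h(2)[of "r n"]
    by (simp add: P_norm_nonneg P_norm_diff_commute[of P "B (r n)"])
  ultimately have "(\<lambda>n. P_norm P (B (r n) - C)) \<longlonglongrightarrow> 0"
    by (rule Lim_null_comparison[rotated, OF _ always_eventually, OF _ allI])
  moreover have "C \<in> op_spectrum s P V A" using lim unfolding op_spectrum_def by blast
  ultimately show ?thesis using r by blast
qed

lemma op_spectrum_nonempty:
  assumes "rich s P V A"
  shows "op_spectrum s P V A \<noteq> {}"
proof -
  obtain h :: "nat \<Rightarrow> int ^ 'n" where "tends_to_infinity h" using tends_to_infinity_exists by blast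
  then show ?thesis using assms unfolding rich_def op_spectrum_def by blast
qed

text \<open>
  The shifts of \<open>B\<close> along any sequence stay in the sequentially compact operator spectrum of \<open>A\<close>.
\<close>

lemma rich_limit_operator:
  assumes A: "A \<in> bdd_ops s" and rich: "rich s P V A" and B: "B \<in> op_spectrum s P V A"
  shows "rich s P V B"
  unfolding rich_def
proof (intro allI impI)
  fix h :: "nat \<Rightarrow> int ^ 'n" assume h: "tends_to_infinity h"
  have Bb: "B \<in> bdd_ops s" using op_spectrum_in_bdd_ops[OF B] .
  have "range (\<lambda>n. conj_shift V (h n) B) \<subseteq> op_spectrum s P V A"
    using conj_shift_in_op_spectrum[OF A B] by blast
  from op_spectrum_seq_compact[OF A rich this] obtain r C where r: "strict_mono (r::nat \<Rightarrow> nat)"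
    and C: "C \<in> op_spectrum s P V A" "(\<lambda>n. P_norm P (conj_shift V (h (r n)) B - C)) \<longlonglongrightarrow> 0" by blast
  have "tends_to_infinity (h \<circ> r)"
    using filterlim_compose[OF h[unfolded tends_to_infinity_def] filterlim_subseq[OF r]]
    by (simp add: tends_to_infinity_def o_def)
  with C have "is_limit_operator s P V B (h \<circ> r) C"
    unfolding is_limit_operator_iff[OF Bb] using op_spectrum_in_bdd_ops by simp
  with r show "\<exists>r C. strict_mono r \<and> is_limit_operator s P V B (h \<circ> r) C" by blast
qed

end

section \<open>Existence of a self-similar recurrent limit operator\<close>

theorem lemma5p15:
  fixes s :: "'k::real_normed_field \<Rightarrow> 'a::banach \<Rightarrow> 'a"
    and P :: "nat \<Rightarrow> 'a \<Rightarrow>\<^sub>L 'a"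
    and V :: "int ^ 'n \<Rightarrow> 'a \<Rightarrow>\<^sub>L 'a"
    and A :: "'a \<Rightarrow>\<^sub>L 'a"
  assumes "limit_operator_setting s P V"
    and "A \<in> bdd_ops s"
    and "rich s P V A"
  shows "\<exists>B \<in> op_spectrum s P V A. self_similar s P V B \<and> recurrent s P V B"
proof -
  interpret limit_operator_setting s P V by fact
  note A = assms(2) and rich = assms(3)
  have "\<exists>B \<in> op_spectrum s P V A. B \<in> op_spectrum s P V B \<and>
    (\<forall>C \<in> op_spectrum s P V B. op_spectrum s P V C = op_spectrum s P V B)"
  proof (rule exists_self_recurrent_point[where d="\<lambda>S T. P_norm P (S - T)"])
    fix B assume B: "B \<in> op_spectrum s P V A"
    show "op_spectrum s P V B \<subseteq> op_spectrum s P V A" by (rule op_spectrum_trans[OF A B])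
    show "op_spectrum s P V B \<noteq> {}" by (rule op_spectrum_nonempty[OF rich_limit_operator[OF A rich B]])
  qed (use P_norm_diff_commute P_norm_triangle op_spectrum_seq_compact[OF A rich]
      op_spectrum_nonempty[OF rich] op_spectrum_closed op_spectrum_trans op_spectrum_in_bdd_ops in \<open>blast+\<close>)
  then show ?thesis unfolding self_similar_def recurrent_def .
qed

end
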